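(* There is no $\psi\in H(\mathbb{D})$ such that the multiplication operator $M_\psi f=\psi f$ is an isometry from $H^\infty(\mathbb{D})$ into $\mathcal{B}(\mathbb{D})$.
   Context: $\mathbb{D}$ is the open unit disk in $\mathbb{C}$, $H(\mathbb{D})$ is the set of holomorphic functions on $\mathbb{D}$, and $H^\infty(\mathbb{D})$ is the space of bounded ones with the supremum norm $\|\cdot\|_\infty$. The Bloch space $\mathcal{B}(\mathbb{D})$ is the set of $f\in H(\mathbb{D})$ with $\beta_f=\sup_{z\in\mathbb{D}}(1-|z|^2)|f'(z)|<\infty$, with norm $\|f\|_{\mathcal{B}}=|f(0)|+\beta_f$. A linear operator $T:H^\infty(\mathbb{D})\to\mathcal{B}(\mathbb{D})$ is an isometry if $\|Tf\|_{\mathcal{B}}=\|f\|_\infty$ for all $f\in H^\infty(\mathbb{D})$ (surjectivity is not required). *)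

theory Defs
  imports "HOL-Complex_Analysis.Complex_Analysis"
begin

text \<open>Functions on the open unit disc are total functions \<^typ>\<open>complex \<Rightarrow> complex\<close> of which only the
  values on the disc matter; no notion below depends on the values elsewhere.\<close>

abbreviation unit_disc :: "complex set" where
  "unit_disc \<equiv> ball 0 1"

definition Hinf :: "(complex \<Rightarrow> complex) set" where
  "Hinf = {f. f holomorphic_on unit_disc \<and> bounded (f ` unit_disc)}"

definition Hinf_norm :: "(complex \<Rightarrow> complex) \<Rightarrow> real" where
  "Hinf_norm f = (SUP z\<in>unit_disc. norm (f z))"

definition bloch_space :: "(complex \<Rightarrow> complex) set" where
  "bloch_space = {f. f holomorphic_on unit_disc \<and>
     bdd_above ((\<lambda>z. (1 - (norm z)\<^sup>2) * norm (deriv f z)) ` unit_disc)}"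

definition bloch_seminorm :: "(complex \<Rightarrow> complex) \<Rightarrow> real" where
  "bloch_seminorm f = (SUP z\<in>unit_disc. (1 - (norm z)\<^sup>2) * norm (deriv f z))"

definition bloch_norm :: "(complex \<Rightarrow> complex) \<Rightarrow> real" where
  "bloch_norm f = norm (f 0) + bloch_seminorm f"

definition linear_operator_Hinf_bloch ::
    "((complex \<Rightarrow> complex) \<Rightarrow> (complex \<Rightarrow> complex)) \<Rightarrow> bool" where
  "linear_operator_Hinf_bloch T \<longleftrightarrow>
     (\<forall>f\<in>Hinf. T f \<in> bloch_space) \<and>
     (\<forall>f\<in>Hinf. \<forall>g\<in>Hinf. (\<forall>z\<in>unit_disc. f z = g z) \<longrightarrow> (\<forall>z\<in>unit_disc. T f z = T g z)) \<and>
     (\<forall>f\<in>Hinf. \<forall>g\<in>Hinf. \<forall>z\<in>unit_disc. T (\<lambda>w. f w + g w) z = T f z + T g z) \<and>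
     (\<forall>c. \<forall>f\<in>Hinf. \<forall>z\<in>unit_disc. T (\<lambda>w. c * f w) z = c * T f z)"

text \<open>The second conjunct above says that \<open>T\<close> is well defined on functions on the disc.\<close>

definition isometry_Hinf_bloch ::
    "((complex \<Rightarrow> complex) \<Rightarrow> (complex \<Rightarrow> complex)) \<Rightarrow> bool" where
  "isometry_Hinf_bloch T \<longleftrightarrow>
     linear_operator_Hinf_bloch T \<and> (\<forall>f\<in>Hinf. bloch_norm (T f) = Hinf_norm f)"

definition mult_op :: "(complex \<Rightarrow> complex) \<Rightarrow> (complex \<Rightarrow> complex) \<Rightarrow> (complex \<Rightarrow> complex)" where
  "mult_op \<psi> f = (\<lambda>z. \<psi> z * f z)"

end

theory Submission
  imports Defs
begin

text \<open>Suppose \<open>M\<^sub>\<psi>\<close> is an isometry. Testing it on the disc automorphism vanishing at \<open>a\<close> gives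
  \<open>|\<psi>(a)| \<le> 1\<close>. Put \<open>g(z) = z\<psi>(z)\<close> and \<open>K = \<parallel>zg\<parallel>\<^sub>\<infinity> \<le> 1\<close>; by the maximum principle also
  \<open>|\<psi>| \<le> K\<close>, so that \<open>g/K\<close> is a self-map of the disc. Testing on \<open>f = zg\<close>, for which
  \<open>\<psi>f = g\<^sup>2\<close>, gives \<open>K = \<beta>(g\<^sup>2)\<close>, whereas the Schwarz--Pick inequality yields
  \<open>\<beta>(g\<^sup>2) \<le> K\<^sup>2 sup 2x(1 - x\<^sup>2) \<le> 4K\<^sup>2/5\<close>. Hence \<open>K = 0\<close> and \<open>\<psi> = 0\<close>, which is absurd.\<close>

lemma one_minus_cnj_mult_neq_0:
  fixes w z :: complex
  assumes "norm w < 1" "norm z < 1"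
  shows "1 - cnj w * z \<noteq> 0"
proof -
  have "norm (cnj w * z) < 1"
    using norm_mult_less[of "cnj w" 1 z 1] assms by simp
  then show ?thesis
    by auto
qed

lemma one_minus_cnj_mult_self:
  "1 - cnj z * z = complex_of_real (1 - (norm z)\<^sup>2)"
  using complex_norm_square[of z] by (simp add: mult.commute)

text \<open>Two values serve below: \<open>1 - (norm w)\<^sup>2\<close> at \<open>z = 0\<close>, and
  its reciprocal at \<open>z = w\<close>, where the squared denominator cancels against the
  numerator.\<close>

lemma Moebius_function_has_field_derivative:
  assumes "norm w < 1" "norm z < 1"
  shows "(Moebius_function 0 w has_field_derivative
           complex_of_real (1 - (norm w)\<^sup>2) / (1 - cnj w * z)\<^sup>2) (at z)"
proof -
  note nz = one_minus_cnj_mult_neq_0[OF assms]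
  have "((\<lambda>z. (z - w) / (1 - cnj w * z)) has_field_derivative
           complex_of_real (1 - (norm w)\<^sup>2) / (1 - cnj w * z)\<^sup>2) (at z)"
    unfolding one_minus_cnj_mult_self[symmetric]
    by (rule derivative_eq_intros refl nz)+ (simp add: power2_eq_square algebra_simps)
  then show ?thesis
    by (simp add: Moebius_function_def)
qed

text \<open>Composing with disc automorphisms on both sides moves \<open>a\<close> and
  \<open>f a\<close> to the origin. The Schwarz lemma bounds the derivative of the composite at 0 by
  1, and the chain rule expresses that derivative through \<open>deriv f a\<close>.\<close>

lemma Schwarz_Pick:
  assumes holf: "f holomorphic_on ball 0 1"
    and f1: "\<And>z. norm z < 1 \<Longrightarrow> norm (f z) < 1"
    and a: "norm a < 1"
  shows "(1 - (norm a)\<^sup>2) * norm (deriv f a) \<le> 1 - (norm (f a))\<^sup>2"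
proof -
  define F where "F = Moebius_function 0 (f a) \<circ> (f \<circ> Moebius_function 0 (- a))"
  have M0: "Moebius_function 0 (- a) 0 = a"
    by (simp add: Moebius_function_def)
  have a': "norm (- a) < 1" "(0::real) < 1 - (norm a)\<^sup>2" "0 < 1 - (norm (f a))\<^sup>2"
    using a f1[OF a] by (simp_all add: abs_square_less_1)
  have holF: "F holomorphic_on ball 0 1"
    unfolding F_def
    using holf f1 a a' Moebius_function_norm_lt_1
    by (intro holomorphic_on_compose_gen[where t = "ball 0 1"] Moebius_function_holomorphic) auto
  have "norm (deriv F 0) \<le> 1"
  proof (rule Schwarz_Lemma(2)[OF holF, where \<xi> = 0])
    show "F 0 = 0"
      by (simp add: F_def M0 Moebius_function_eq_zero)
    show "norm (F z) < 1" if "norm z < 1" for z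
      using that f1 a a' by (simp add: F_def Moebius_function_norm_lt_1)
  qed simp_all
  moreover have "(F has_field_derivative
      (1 / complex_of_real (1 - (norm (f a))\<^sup>2)) * (deriv f a * complex_of_real (1 - (norm a)\<^sup>2))) (at 0)"
    unfolding F_def
  proof (intro DERIV_chain)
    show "(Moebius_function 0 (- a) has_field_derivative complex_of_real (1 - (norm a)\<^sup>2)) (at 0)"
      using Moebius_function_has_field_derivative[OF a'(1), of 0] by simp
    show "(f has_field_derivative deriv f a) (at (Moebius_function 0 (- a) 0))"
      unfolding M0 using holf a by (intro holomorphic_derivI[where S = "ball 0 1"]) auto
    have "(Moebius_function 0 (f a) has_field_derivative
        1 / complex_of_real (1 - (norm (f a))\<^sup>2)) (at (f a))"
      using Moebius_function_has_field_derivative[OF f1[OF a] f1[OF a]] a'(3)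
      unfolding one_minus_cnj_mult_self power2_eq_square[of "complex_of_real _"]
      by (metis nonzero_divide_mult_cancel_left of_real_eq_0_iff less_irrefl)
    then show "(Moebius_function 0 (f a) has_field_derivative
        1 / complex_of_real (1 - (norm (f a))\<^sup>2)) (at ((f \<circ> Moebius_function 0 (- a)) 0))"
      by (simp add: M0)
  qed
  ultimately have "norm ((1 / complex_of_real (1 - (norm (f a))\<^sup>2)) *
      (deriv f a * complex_of_real (1 - (norm a)\<^sup>2))) \<le> 1"
    by (simp only: DERIV_imp_deriv)
  then have "1 / (1 - (norm (f a))\<^sup>2) * (norm (deriv f a) * (1 - (norm a)\<^sup>2)) \<le> 1"
    using a' unfolding norm_mult norm_divide norm_of_real norm_one by simp
  then show ?thesis
    using a'(3) by (simp add: field_simps)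
qed

text \<open>On the circle of radius \<open>r\<close> the hypothesis reads
  \<open>norm (h z) \<le> K / r ^ n\<close>. The maximum principle carries this bound inside, and
  \<open>r\<close> tends to 1.\<close>

lemma norm_le_of_power_mult_le:
  fixes h :: "complex \<Rightarrow> complex"
  assumes holh: "h holomorphic_on ball 0 1"
    and le: "\<And>z. norm z < 1 \<Longrightarrow> norm (z ^ n * h z) \<le> K"
    and a: "norm a < 1"
  shows "norm (h a) \<le> K"
proof -
  have "r ^ n * norm (h a) \<le> K" if r: "norm a < r" "r < 1" for r :: real
  proof -
    have r0: "0 < r" using r(1) norm_ge_zero[of a] by linarith
    have sub: "cball 0 r \<subseteq> (ball 0 1 :: complex set)" using r by auto
    have "norm (h a) \<le> K / r ^ n"
    proof (rule maximum_modulus_frontier[where f = h and S = "ball 0 r"])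
      show "h holomorphic_on interior (ball 0 r)"
        using holh by (rule holomorphic_on_subset) (use sub in auto)
      show "continuous_on (closure (ball 0 r)) h"
        using continuous_on_subset[OF holomorphic_on_imp_continuous_on[OF holh] sub] r0 by simp
      show "norm (h z) \<le> K / r ^ n" if z: "z \<in> frontier (ball 0 r)" for z
        using z r0 r le[of z] by (simp add: norm_mult norm_power field_simps)
    qed (use r in auto)
    then show ?thesis using r0 by (simp add: field_simps)
  qed
  then have "\<forall>\<^sub>F r in at_left 1. r ^ n * norm (h a) \<le> K"
    using eventually_at_left_field[of _ "1::real"] a by blast
  moreover have "((\<lambda>r::real. r ^ n * norm (h a)) \<longlongrightarrow> 1 ^ n * norm (h a)) (at_left 1)"
    by (intro tendsto_intros)
  ultimately show ?thesis
    using tendsto_upperbound[of "\<lambda>r. r ^ n * norm (h a)" "1 ^ n * norm (h a)" "at_left 1" K]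
    by (simp add: trivial_limit_at_left_real)
qed

text \<open>The true maximum is \<open>4 / (3 * sqrt 3)\<close>, about 0.77, attained at
  \<open>1 / sqrt 3\<close>. Any constant below 1 suffices for the contradiction.\<close>

lemma cubic_bound:
  fixes x :: real
  assumes "0 \<le> x" "x \<le> 1"
  shows "2 * x * (1 - x\<^sup>2) \<le> 4 / 5"
proof -
  \<comment> \<open>Here \<open>4/7\<close> is a rational approximation of
    \<open>1 / sqrt 3\<close>, and \<open>8/7\<close> makes the quadratic term vanish. The remaining
    linear error is absorbed by \<open>x \<le> 1\<close>.\<close>
  have "0 \<le> (x - 4/7)\<^sup>2 * (x + 8/7)"
    using assms by (intro mult_nonneg_nonneg) auto
  also have "\<dots> = x * x * x - 48/49 * x + 128/343"
    by (simp add: power2_eq_square field_simps)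
  finally show ?thesis
    using assms by (simp add: power2_eq_square algebra_simps)
qed

lemma norm_le_Hinf_norm:
  assumes "f \<in> Hinf" "norm z < 1"
  shows "norm (f z) \<le> Hinf_norm f"
  unfolding Hinf_norm_def
  using assms by (intro cSUP_upper) (auto simp: Hinf_def bounded_imp_bdd_above bounded_norm_comp)

lemma bloch_seminorm_upper:
  assumes "f \<in> bloch_space" "norm z < 1"
  shows "(1 - (norm z)\<^sup>2) * norm (deriv f z) \<le> bloch_seminorm f"
  unfolding bloch_seminorm_def
  using assms by (intro cSUP_upper) (auto simp: bloch_space_def)

theorem theorem6p2:
  shows "\<not> (\<exists>\<psi>. \<psi> holomorphic_on unit_disc \<and> isometry_Hinf_bloch (mult_op \<psi>))"
proof
  assume "\<exists>\<psi>. \<psi> holomorphic_on unit_disc \<and> isometry_Hinf_bloch (mult_op \<psi>)"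
  then obtain \<psi> where hol: "\<psi> holomorphic_on unit_disc"
    and iso: "isometry_Hinf_bloch (mult_op \<psi>)"
    by blast
  have bloch: "mult_op \<psi> f \<in> bloch_space" if "f \<in> Hinf" for f
    using iso that by (auto simp: isometry_Hinf_bloch_def linear_operator_Hinf_bloch_def)
  have norm_eq: "bloch_norm (mult_op \<psi> f) = Hinf_norm f" if "f \<in> Hinf" for f
    using iso that by (auto simp: isometry_Hinf_bloch_def)

  have psi_le_1: "norm (\<psi> a) \<le> 1" if a: "norm a < 1" for a
  proof -
    \<comment> \<open>As \<open>f a = 0\<close>, the product rule at \<open>a\<close> loses its term
      with \<open>deriv \<psi> a\<close>. In the other term the derivative of \<open>f\<close>
      cancels the Bloch weight exactly.\<close>
    define f where "f = Moebius_function 0 a"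
    have f1: "norm (f z) \<le> 1" if "norm z < 1" for z
      using Moebius_function_norm_lt_1[OF a that, of 0] by (simp add: f_def)
    have f: "f \<in> Hinf"
      using Moebius_function_holomorphic[OF a] f1
      by (auto simp: Hinf_def f_def bounded_iff intro!: exI[of _ 1])
    have pos: "0 < 1 - (norm a)\<^sup>2"
      using a by (simp add: abs_square_less_1)
    have "(f has_field_derivative 1 / complex_of_real (1 - (norm a)\<^sup>2)) (at a)"
      using Moebius_function_has_field_derivative[OF a a] pos
      unfolding one_minus_cnj_mult_self power2_eq_square[of "complex_of_real _"] f_def
      by (metis nonzero_divide_mult_cancel_left of_real_eq_0_iff less_irrefl)
    moreover have "(\<psi> has_field_derivative deriv \<psi> a) (at a)"
      using hol a by (intro holomorphic_derivI[where S = unit_disc]) auto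
    ultimately have "(mult_op \<psi> f has_field_derivative
        deriv \<psi> a * f a + 1 / complex_of_real (1 - (norm a)\<^sup>2) * \<psi> a) (at a)"
      unfolding mult_op_def by (intro DERIV_mult)
    moreover have "f a = 0"
      by (simp add: f_def Moebius_function_eq_zero)
    ultimately have "deriv (mult_op \<psi> f) a = 1 / complex_of_real (1 - (norm a)\<^sup>2) * \<psi> a"
      using DERIV_imp_deriv by force
    then have "norm (deriv (mult_op \<psi> f) a) = 1 / (1 - (norm a)\<^sup>2) * norm (\<psi> a)"
      using pos by (simp only: norm_mult norm_divide norm_of_real norm_one)
    then have "norm (\<psi> a) = (1 - (norm a)\<^sup>2) * norm (deriv (mult_op \<psi> f) a)"
      using pos by simp
    also have "\<dots> \<le> bloch_norm (mult_op \<psi> f)"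
      using bloch_seminorm_upper[OF bloch[OF f] a]
      unfolding bloch_norm_def by (intro add_increasing) auto
    also have "\<dots> \<le> 1"
      unfolding norm_eq[OF f] Hinf_norm_def using f1 by (intro cSUP_least) auto
    finally show ?thesis .
  qed

  define g where "g = (\<lambda>z. z * \<psi> z)"
  \<comment> \<open>The factor \<open>z ^ 2\<close> makes \<open>\<psi> * f\<close> the square of
    \<open>g\<close>, vanishing at 0, so that its Bloch norm is the seminorm alone.\<close>
  define f where "f = (\<lambda>z. z ^ 2 * \<psi> z)"
  define K where "K = Hinf_norm f"
  have f1: "norm (f z) \<le> 1" if "norm z < 1" for z
    using mult_mono[of "(norm z)\<^sup>2" 1 "norm (\<psi> z)" 1] psi_le_1[OF that] that
    by (simp add: f_def norm_mult norm_power power_le_one)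
  have f: "f \<in> Hinf"
    using hol f1 by (auto simp: Hinf_def f_def bounded_iff intro!: holomorphic_intros exI[of _ 1])
  have psi_le: "norm (\<psi> z) \<le> K" if "norm z < 1" for z
    using norm_le_of_power_mult_le[OF hol _ that, of 2 K] norm_le_Hinf_norm[OF f]
    by (simp add: f_def K_def)
  have K1: "K \<le> 1"
    unfolding K_def Hinf_norm_def using f1 by (intro cSUP_least) auto
  \<comment> \<open>If \<open>K = 0\<close>, then \<open>\<psi>\<close> vanishes on the disc and
    sends the constant 1, of norm 1, to a function of Bloch norm 0.\<close>
  have "K \<noteq> 0"
  proof
    assume "K = 0"
    then have psi0: "\<psi> z = 0" if "norm z < 1" for z
      using psi_le[OF that] by simp
    have "deriv (mult_op \<psi> (\<lambda>_. 1)) z = 0" if "norm z < 1" for z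
    proof -
      \<comment> \<open>\<open>\<psi>\<close> is known to vanish only on the disc, so the derivative
        is computed from the values near \<open>z\<close>.\<close>
      have "\<forall>\<^sub>F w in nhds z. mult_op \<psi> (\<lambda>_. 1) w = 0"
        using that psi0 by (auto simp: mult_op_def eventually_nhds intro!: exI[of _ "ball 0 1"])
      then show ?thesis
        using deriv_cong_ev[of "mult_op \<psi> (\<lambda>_. 1)" "\<lambda>_. 0" z z] by simp
    qed
    then have "bloch_norm (mult_op \<psi> (\<lambda>_. 1)) = 0"
      using psi0[of 0] by (simp add: bloch_norm_def bloch_seminorm_def mult_op_def)
    moreover have "(\<lambda>_. 1) \<in> Hinf"
      by (auto simp: Hinf_def bounded_iff)
    ultimately show False
      using norm_eq[of "\<lambda>_. 1"] by (simp add: Hinf_norm_def)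
  qed
  then have K0: "0 < K"
    using order_trans[OF norm_ge_zero psi_le[of 0]] by simp

  have "(1 - (norm z)\<^sup>2) * norm (deriv (mult_op \<psi> f) z) \<le> 4 / 5 * K\<^sup>2" if z: "norm z < 1" for z
  proof -
    \<comment> \<open>The factor \<open>z\<close> in \<open>g\<close> turns
      \<open>norm (\<psi> z) \<le> K\<close> into the strict bound \<open>norm (h z) < 1\<close>
      that \<open>Schwarz_Pick\<close> requires.\<close>
    define h where "h = (\<lambda>z. g z / complex_of_real K)"
    define x where "x = norm (h z)"
    have holh: "h holomorphic_on ball 0 1"
      unfolding h_def g_def using hol K0 by (intro holomorphic_intros) auto
    have h1: "norm (h w) < 1" if "norm w < 1" for w
    proof -
      have "norm (h w) = norm w * (norm (\<psi> w) / K)"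
        using K0 by (simp add: h_def g_def norm_mult norm_divide)
      also have "\<dots> \<le> norm w * 1"
        using psi_le[OF that] K0 by (intro mult_left_mono) (auto simp: field_simps)
      finally show ?thesis using that by simp
    qed
    have "(h has_field_derivative deriv h z) (at z)"
      using holh z by (intro holomorphic_derivI[where S = unit_disc]) auto
    then have "((\<lambda>w. (complex_of_real K)\<^sup>2 * (h w)\<^sup>2) has_field_derivative
        (complex_of_real K)\<^sup>2 * (2 * h z * deriv h z)) (at z)"
      by (auto intro!: derivative_eq_intros)
    moreover have "mult_op \<psi> f = (\<lambda>w. (complex_of_real K)\<^sup>2 * (h w)\<^sup>2)"
      using K0 by (auto simp: mult_op_def f_def h_def g_def power2_eq_square fun_eq_iff)
    ultimately have "deriv (mult_op \<psi> f) z = (complex_of_real K)\<^sup>2 * (2 * h z * deriv h z)"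
      by (simp add: DERIV_imp_deriv)
    then have "(1 - (norm z)\<^sup>2) * norm (deriv (mult_op \<psi> f) z)
        = K\<^sup>2 * (2 * x * ((1 - (norm z)\<^sup>2) * norm (deriv h z)))"
      by (simp add: x_def norm_mult norm_power)
    also have "\<dots> \<le> K\<^sup>2 * (2 * x * (1 - x\<^sup>2))"
      unfolding x_def using Schwarz_Pick[OF holh h1 z] by (intro mult_left_mono) auto
    also have "\<dots> \<le> K\<^sup>2 * (4 / 5)"
      using cubic_bound[of x] h1[OF z] by (intro mult_left_mono) (auto simp: x_def)
    finally show ?thesis by (simp add: mult.commute)
  qed
  then have "bloch_seminorm (mult_op \<psi> f) \<le> 4 / 5 * K\<^sup>2"
    unfolding bloch_seminorm_def by (intro cSUP_least) auto
  moreover have "K = bloch_seminorm (mult_op \<psi> f)"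
    using norm_eq[OF f] by (simp add: K_def bloch_norm_def mult_op_def f_def)
  \<comment> \<open>Together these give \<open>K \<le> 4 / 5 * K\<close>, impossible for positive
    \<open>K\<close>.\<close>
  moreover have "K\<^sup>2 \<le> K"
    using K0 K1 by (simp add: power2_eq_square mult_left_le)
  ultimately show False
    using K0 by linarith
qed

end
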